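(* Let $M$ be a monoid. Then $\mathfrak{L}(\mathrm{Val},\mathrm{CF},M)$ either (i) equals the class of context-free languages, (ii) contains $\mathfrak{L}(\mathrm{Val},\mathrm{CF},\mathrm{B})$, (iii) contains $\mathfrak{L}(\mathrm{Val},\mathrm{CF},\mathbb{Z})$, or (iv) equals $\mathfrak{L}(\mathrm{Val},\mathrm{CF},G)$ for some infinite periodic group $G$ which is not locally finite.
   Context: A context-free valence grammar over a monoid $N$ is $(V,T,P,S,N)$ with nonterminals $V$, terminals $T$, start symbol $S$ and a finite set $P$ of rules $(A\to\alpha,n)$ with $A\in V$, $\alpha\in(V\cup T)^*$, $n\in N$. One step: $(w_1Aw_2,m)\Rightarrow(w_1\alpha w_2,mn)$ for a rule $(A\to\alpha,n)$. The generated language is $\{w\in T^*:(S,1)\Rightarrow^*(w,1)\}$; $\mathfrak{L}(\mathrm{Val},\mathrm{CF},N)$ is the family of languages generated by such grammars over $N$. $\mathrm{B}$ is the bicyclic monoid, i.e. the monoid of partial functions on $\{x\}^*$ generated by $P:u\mapsto ux$ and $Q:ux\mapsto u$ (equivalently the monoid presentation $\langle p,q\mid pq=1\rangle$). $\mathbb{Z}$ is the additive group of integers. A group is periodic if every element has finite order, and locally finite if every finitely generated subgroup is finite. *)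

theory Defs
  imports "HOL-Algebra.Algebra"
begin

text \<open>Sentential forms are lists over nonterminals (Inl, indexed by nat) and
terminals (Inr, indexed by nat).  Terminal alphabets are finite subsets of nat,
so every language over a finite alphabet is represented up to renaming.\<close>

type_synonym sym = "nat + nat"

definition cf_grammar :: "nat set \<Rightarrow> nat set \<Rightarrow> (nat \<times> sym list) set \<Rightarrow> nat \<Rightarrow> bool" where
  "cf_grammar V T P S \<longleftrightarrow> finite V \<and> finite T \<and> finite P \<and> S \<in> V \<and>
     (\<forall>(A, \<alpha>) \<in> P. A \<in> V \<and> set \<alpha> \<subseteq> Inl ` V \<union> Inr ` T)"

definition cf_step :: "(nat \<times> sym list) set \<Rightarrow> (sym list \<times> sym list) set" where
  "cf_step P = {(w1 @ [Inl A] @ w2, w1 @ \<alpha> @ w2) | w1 w2 A \<alpha>. (A, \<alpha>) \<in> P}"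

definition cf_lang :: "nat set \<Rightarrow> (nat \<times> sym list) set \<Rightarrow> nat \<Rightarrow> nat list set" where
  "cf_lang T P S = {w. set w \<subseteq> T \<and> ([Inl S], map Inr w) \<in> (cf_step P)\<^sup>*}"

definition CFL :: "nat list set set" where
  "CFL = {L. \<exists>V T P S. cf_grammar V T P S \<and> L = cf_lang T P S}"

definition val_grammar ::
  "('m, 'x) monoid_scheme \<Rightarrow> nat set \<Rightarrow> nat set \<Rightarrow> (nat \<times> sym list \<times> 'm) set \<Rightarrow> nat \<Rightarrow> bool" where
  "val_grammar M V T P S \<longleftrightarrow> finite V \<and> finite T \<and> finite P \<and> S \<in> V \<and>
     (\<forall>(A, \<alpha>, n) \<in> P. A \<in> V \<and> set \<alpha> \<subseteq> Inl ` V \<union> Inr ` T \<and> n \<in> carrier M)"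

definition val_step ::
  "('m, 'x) monoid_scheme \<Rightarrow> (nat \<times> sym list \<times> 'm) set \<Rightarrow> ((sym list \<times> 'm) \<times> (sym list \<times> 'm)) set" where
  "val_step M P = {((w1 @ [Inl A] @ w2, m), (w1 @ \<alpha> @ w2, m \<otimes>\<^bsub>M\<^esub> n)) | w1 w2 A \<alpha> m n.
      (A, \<alpha>, n) \<in> P}"

definition val_lang ::
  "('m, 'x) monoid_scheme \<Rightarrow> nat set \<Rightarrow> (nat \<times> sym list \<times> 'm) set \<Rightarrow> nat \<Rightarrow> nat list set" where
  "val_lang M T P S = {w. set w \<subseteq> T \<and>
     (([Inl S], \<one>\<^bsub>M\<^esub>), (map Inr w, \<one>\<^bsub>M\<^esub>)) \<in> (val_step M P)\<^sup>*}"

definition LValCF :: "('m, 'x) monoid_scheme \<Rightarrow> nat list set set" where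
  "LValCF M = {L. \<exists>V T P S. val_grammar M V T P S \<and> L = val_lang M T P S}"

text \<open>The bicyclic monoid B = <p,q | pq = 1>; the pair (a,b) represents the
normal form q^a p^b, and p^b q^c reduces to q^(c-b) p^(b-c).\<close>

definition bicyclic :: "(nat \<times> nat) monoid" where
  "bicyclic = \<lparr>carrier = UNIV,
     monoid.mult = (\<lambda>(a, b) (c, d). (a + (c - b), d + (b - c))),
     one = (0, 0)\<rparr>"

definition periodic_group :: "('g, 'x) monoid_scheme \<Rightarrow> bool" where
  "periodic_group G \<longleftrightarrow> group G \<and>
     (\<forall>g \<in> carrier G. \<exists>n::nat. n > 0 \<and> g [^]\<^bsub>G\<^esub> n = \<one>\<^bsub>G\<^esub>)"

definition locally_finite_group :: "('g, 'x) monoid_scheme \<Rightarrow> bool" where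
  "locally_finite_group G \<longleftrightarrow> group G \<and>
     (\<forall>S. S \<subseteq> carrier G \<and> finite S \<longrightarrow> finite (generate G S))"

end

theory Submission
  imports Defs
begin

text \<open>If \<open>pq = 1 \<noteq> qp\<close> for some \<open>p, q\<close>, then \<open>M\<close> contains the bicyclic monoid.  Otherwise every
  factor of 1 is a unit, so only rules with valences in the group of units matter; a unit of
  infinite order yields a copy of the integers.  It remains to see that a finite group adds no
  power to context-free grammars.  A derivation tree contributes the set of linearizations of its
  valences, and trees are combined by shuffling.  In any context a linearization can be replaced
  by a profile: a word of length at most \<open>|G|\<^sup>3\<close> that is at most as powerful in every context.
  Annotating nonterminals with their profiles gives an equivalent context-free grammar.\<close>

section \<open>Shuffles\<close>

text \<open>Nonterminals may be rewritten in any order and the group need not be abelian, so a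
  subtree has no single group value: valences applied elsewhere may fall between its own. It is
  therefore judged by the values it yields together with an arbitrary context, the list of valences
  applied outside it. A profile cannot be exact, because dropping a segment with trivial product may
  lose interleavings. It meets two demands of different kinds: in every context it yields only
  values that the original list yields too, and it keeps one chosen value in one chosen context. The
  first makes every annotated derivation realizable, the second lets every derivation with value 1
  be annotated. Since a context-free rule cannot see its context, the profile is guessed in the
  annotation and checked locally. Passing from finite to locally finite groups costs nothing: a
  grammar mentions finitely many valences, so all its values lie in one finitely generated
  subgroup.\<close>

lemma shuffles_assocD:
  assumes "x \<in> shuffles a b" and "s \<in> shuffles x c"
  shows "\<exists>y \<in> shuffles b c. s \<in> shuffles a y"
  using assms
proof (induction s arbitrary: x a b c)
  case Nil
  then show ?case by auto
next
  case (Cons h s)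
  from Cons.prems(2) consider
    x' where "x = h # x'" "s \<in> shuffles x' c" | c' where "c = h # c'" "s \<in> shuffles x c'"
    by (auto simp: Cons_in_shuffles_iff neq_Nil_conv)
  then show ?case
  proof cases
    case 1
    from Cons.prems(1) 1(1) consider
      a' where "a = h # a'" "x' \<in> shuffles a' b" | b' where "b = h # b'" "x' \<in> shuffles a b'"
      by (auto simp: Cons_in_shuffles_iff neq_Nil_conv)
    then show ?thesis
    proof cases
      case 1
      with Cons.IH[OF 1(2) \<open>s \<in> shuffles x' c\<close>] show ?thesis
        by (auto intro: Cons_in_shuffles_leftI)
    next
      case 2
      with Cons.IH[OF 2(2) \<open>s \<in> shuffles x' c\<close>] show ?thesis
        by (metis Cons_in_shuffles_leftI Cons_in_shuffles_rightI)
    qed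
  next
    case 2
    with Cons.IH[OF Cons.prems(1) 2(2)] show ?thesis
      by (metis Cons_in_shuffles_rightI)
  qed
qed

lemma shuffles_assoc:
  "(\<exists>x \<in> shuffles a b. s \<in> shuffles x c) \<longleftrightarrow> (\<exists>y \<in> shuffles b c. s \<in> shuffles a y)"
proof
  assume "\<exists>y \<in> shuffles b c. s \<in> shuffles a y"
  then obtain y where "y \<in> shuffles c b" "s \<in> shuffles y a"
    by (auto simp: shuffles_commutes)
  from shuffles_assocD[OF this] show "\<exists>x \<in> shuffles a b. s \<in> shuffles x c"
    by (auto simp: shuffles_commutes)
qed (blast dest: shuffles_assocD)

lemma append_in_shuffles_append:
  assumes "s1 \<in> shuffles v1 c1" and "s2 \<in> shuffles v2 c2"
  shows "s1 @ s2 \<in> shuffles (v1 @ v2) (c1 @ c2)"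
  using assms
proof (induction s1 arbitrary: v1 c1)
  case (Cons h s1)
  then consider v1' where "v1 = h # v1'" "s1 \<in> shuffles v1' c1"
    | c1' where "c1 = h # c1'" "s1 \<in> shuffles v1 c1'"
    by (auto simp: Cons_in_shuffles_iff neq_Nil_conv)
  then show ?case
    by cases (use Cons.IH[OF _ Cons.prems(2)] in
      \<open>auto intro: Cons_in_shuffles_leftI Cons_in_shuffles_rightI\<close>)
qed simp

lemma append_in_shuffles: "a @ b \<in> shuffles a b"
  using append_in_shuffles_append[of a a "[]" b "[]" b] by simp

text \<open>The cut is placed directly behind the last letter of \<open>v1\<close>, or at the front
  if \<open>v1\<close> is empty, and \<open>c\<close> is cut at the same place.\<close>

lemma shuffles_appendD:
  assumes "s \<in> shuffles (v1 @ v2) c"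
  shows "\<exists>s1 s2 c1 c2. s = s1 @ s2 \<and> c = c1 @ c2 \<and> s1 \<in> shuffles v1 c1 \<and> s2 \<in> shuffles v2 c2"
  using assms
proof (induction s arbitrary: v1 c)
  case Nil
  then show ?case by auto
next
  case (Cons h s)
  show ?case
  proof (cases v1)
    case Nil
    with Cons.prems show ?thesis
      by (intro exI[of _ "[]"] exI[of _ "h # s"] exI[of _ c]) auto
  next
    case (Cons k v1')
    with Cons.prems consider
      "k = h" "s \<in> shuffles (v1' @ v2) c" | c' where "c = h # c'" "s \<in> shuffles (v1 @ v2) c'"
      by (auto simp: Cons_in_shuffles_iff neq_Nil_conv)
    then show ?thesis
    proof cases
      case 1
      from Cons.IH[OF 1(2)] obtain s1 s2 c1 c2 where
        "s = s1 @ s2" "c = c1 @ c2" "s1 \<in> shuffles v1' c1" "s2 \<in> shuffles v2 c2" by blast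
      with Cons 1 show ?thesis
        by (intro exI[of _ "h # s1"] exI[of _ s2] exI[of _ c1] exI[of _ c2])
          (auto intro: Cons_in_shuffles_leftI)
    next
      case 2
      from Cons.IH[OF 2(2)] obtain s1 s2 c1 c2 where
        "s = s1 @ s2" "c' = c1 @ c2" "s1 \<in> shuffles v1 c1" "s2 \<in> shuffles v2 c2" by blast
      with 2 show ?thesis
        by (intro exI[of _ "h # s1"] exI[of _ s2] exI[of _ "h # c1"] exI[of _ c2])
          (auto intro: Cons_in_shuffles_rightI)
    qed
  qed
qed

lemma shuffles_ConsD:
  assumes "s \<in> shuffles (g # v) c"
  shows "\<exists>c1 c2 s2. s = c1 @ g # s2 \<and> c = c1 @ c2 \<and> s2 \<in> shuffles v c2"
  using assms
proof (induction s arbitrary: c)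
  case (Cons h s)
  then consider "g = h" "s \<in> shuffles v c" | c' where "c = h # c'" "s \<in> shuffles (g # v) c'"
    by (auto simp: Cons_in_shuffles_iff neq_Nil_conv)
  then show ?case
  proof cases
    case 1
    then show ?thesis
      by (intro exI[of _ "[]"] exI[of _ c] exI[of _ s]) auto
  next
    case 2
    from Cons.IH[OF 2(2)] 2(1) show ?thesis
      by (metis append_Cons)
  qed
qed simp

text \<open>Each letter of \<open>v\<close> is paired with the stretch of \<open>c\<close> between
  it and the next letter of \<open>v\<close>; \<open>c0\<close> is what precedes the first one. A
  segment of the single list \<open>ps\<close> then determines matching segments of
  \<open>v\<close>, of \<open>c\<close> and of the shuffle.\<close>

lemma shuffles_blocks:
  assumes "s \<in> shuffles v c"
  shows "\<exists>c0 ps. s = c0 @ concat (map (\<lambda>(x, d). x # d) ps) \<and> v = map fst ps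
    \<and> c = c0 @ concat (map snd ps)"
  using assms
proof (induction v arbitrary: s c)
  case Nil
  then show ?case by (intro exI[of _ c] exI[of _ "[]"]) auto
next
  case (Cons g v)
  from shuffles_ConsD[OF Cons.prems] obtain c1 c2 s2 where
    s: "s = c1 @ g # s2" "c = c1 @ c2" "s2 \<in> shuffles v c2" by blast
  from Cons.IH[OF s(3)] obtain c0 ps where
    "s2 = c0 @ concat (map (\<lambda>(x, d). x # d) ps)" "v = map fst ps" "c2 = c0 @ concat (map snd ps)"
    by blast
  with s show ?case
    by (intro exI[of _ c1] exI[of _ "(g, c0) # ps"]) auto
qed

lemma blocks_in_shuffles:
  "concat (map (\<lambda>(x, d). x # d) ps) \<in> shuffles (map fst ps) (concat (map snd ps))"
proof (induction ps)
  case (Cons p ps)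
  obtain x d where p: "p = (x, d)" by force
  have "(x # d) @ concat (map (\<lambda>(x, d). x # d) ps)
      \<in> shuffles ([x] @ map fst ps) (d @ concat (map snd ps))"
    by (rule append_in_shuffles_append[OF _ Cons.IH]) (use append_in_shuffles[of "[x]" d] in simp)
  with p show ?case by simp
qed simp


section \<open>Values of shuffles in a monoid\<close>

definition list_mult :: "('m, 'x) monoid_scheme \<Rightarrow> 'm list \<Rightarrow> 'm" where
  "list_mult G u = foldr (\<otimes>\<^bsub>G\<^esub>) u \<one>\<^bsub>G\<^esub>"

lemma list_mult_Nil [simp]: "list_mult G [] = \<one>\<^bsub>G\<^esub>"
  and list_mult_Cons [simp]: "list_mult G (g # u) = g \<otimes>\<^bsub>G\<^esub> list_mult G u"
  by (simp_all add: list_mult_def)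

text \<open>The intended reading is that \<open>v\<close> linearizes a part of a derivation and
  \<open>c\<close> the rest of it.\<close>

definition shuffle_values :: "('m, 'x) monoid_scheme \<Rightarrow> 'm list \<Rightarrow> 'm list \<Rightarrow> 'm set" where
  "shuffle_values G v c = list_mult G ` shuffles v c"

lemma shuffle_values_Nil [simp]:
  "shuffle_values G v [] = {list_mult G v}" "shuffle_values G [] c = {list_mult G c}"
  by (simp_all add: shuffle_values_def)

text \<open>This moves \<open>b\<close> from the list under study into its context. Together with
  the variant below, which moves \<open>a\<close> instead, it lets one subtree be replaced while its
  siblings count as context.\<close>

lemma shuffle_values_assoc:
  "(\<exists>x \<in> shuffles a b. z \<in> shuffle_values G x c) \<longleftrightarrow>
   (\<exists>y \<in> shuffles b c. z \<in> shuffle_values G a y)"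
  using shuffles_assoc[of a b _ c] unfolding shuffle_values_def by blast

lemma shuffle_values_assoc':
  "(\<exists>x \<in> shuffles a b. z \<in> shuffle_values G x c) \<longleftrightarrow>
   (\<exists>y \<in> shuffles a c. z \<in> shuffle_values G b y)"
  using shuffle_values_assoc[of b a z G c] by (simp add: shuffles_commutes)

context monoid
begin

lemma list_mult_closed [simp, intro]: "set u \<subseteq> carrier G \<Longrightarrow> list_mult G u \<in> carrier G"
  by (induction u) auto

lemma list_mult_append:
  "set u \<subseteq> carrier G \<Longrightarrow> set v \<subseteq> carrier G \<Longrightarrow>
    list_mult G (u @ v) = list_mult G u \<otimes> list_mult G v"
  by (induction u) (auto simp: m_assoc)

text \<open>A rule is applied before anything below it. Once \<open>g\<close> and the context
  \<open>c1\<close> applied earlier are split off, the subtree below the rule faces only the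
  remaining context \<open>c2\<close>, which is the form that an induction over trees can
  use.\<close>

lemma shuffle_values_Cons:
  assumes "g \<in> carrier G" "set u \<subseteq> carrier G" "set c \<subseteq> carrier G"
  shows "z \<in> shuffle_values G (g # u) c \<longleftrightarrow>
    (\<exists>c1 c2 y. c = c1 @ c2 \<and> y \<in> shuffle_values G u c2 \<and> z = list_mult G c1 \<otimes> (g \<otimes> y))"
    (is "?L \<longleftrightarrow> ?R")
proof
  assume ?L
  then obtain s where s: "s \<in> shuffles (g # u) c" "z = list_mult G s"
    by (auto simp: shuffle_values_def)
  from shuffles_ConsD[OF s(1)] obtain c1 c2 t where
    t: "s = c1 @ g # t" "c = c1 @ c2" "t \<in> shuffles u c2" by blast
  have "set t \<subseteq> carrier G" using set_shuffles[OF t(3)] t(2) assms by auto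
  with s t assms show ?R
    by (intro exI[of _ c1] exI[of _ c2] exI[of _ "list_mult G t"])
      (auto simp: shuffle_values_def list_mult_append)
next
  assume ?R
  then obtain c1 c2 t where t: "c = c1 @ c2" "t \<in> shuffles u c2"
    "z = list_mult G c1 \<otimes> (g \<otimes> list_mult G t)"
    by (auto simp: shuffle_values_def)
  have "c1 @ g # t \<in> shuffles ([] @ g # u) (c1 @ c2)"
    using t(2) by (intro append_in_shuffles_append Cons_in_shuffles_leftI) auto
  moreover have "set t \<subseteq> carrier G" using set_shuffles[OF t(2)] t(1) assms by auto
  then have "z = list_mult G (c1 @ g # t)" using t assms by (simp add: list_mult_append)
  ultimately show ?L using t(1) by (auto simp: shuffle_values_def)
qed

text \<open>The block \<open>y\<close> is inserted in one piece, with no letter of the context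
  inside it, so it contributes only its trivial product. Hence deleting such a block never creates
  new values.\<close>

lemma shuffle_values_insert:
  assumes "set a \<subseteq> carrier G" "set y \<subseteq> carrier G" "set b \<subseteq> carrier G" "set c \<subseteq> carrier G"
    and "list_mult G y = \<one>" and "z \<in> shuffle_values G (a @ b) c"
  shows "z \<in> shuffle_values G (a @ y @ b) c"
proof -
  from assms(6) obtain s where s: "s \<in> shuffles (a @ b) c" "z = list_mult G s"
    by (auto simp: shuffle_values_def)
  from shuffles_appendD[OF s(1)] obtain s1 s2 c1 c2 where
    t: "s = s1 @ s2" "c = c1 @ c2" "s1 \<in> shuffles a c1" "s2 \<in> shuffles b c2" by blast
  have "set s1 \<subseteq> carrier G" "set s2 \<subseteq> carrier G"
    using set_shuffles[OF t(3)] set_shuffles[OF t(4)] assms t(2) by auto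
  then have "list_mult G (s1 @ y @ s2) = z"
    using s t assms by (simp add: list_mult_append)
  moreover have "s1 @ y @ s2 \<in> shuffles (a @ y @ b) (c1 @ [] @ c2)"
    by (intro append_in_shuffles_append t) auto
  ultimately show ?thesis using t(2) by (auto simp: shuffle_values_def)
qed

end

definition shuffle_le :: "('m, 'x) monoid_scheme \<Rightarrow> 'm list \<Rightarrow> 'm list \<Rightarrow> bool" where
  "shuffle_le G v u \<longleftrightarrow>
    (\<forall>c. set c \<subseteq> carrier G \<longrightarrow> shuffle_values G v c \<subseteq> shuffle_values G u c)"

text \<open>Write the shuffle as \<open>c\<^sub>0 x\<^sub>1 c\<^sub>1 \<dots> x\<^sub>n c\<^sub>n\<close> with \<open>v = x\<^sub>1 \<dots> x\<^sub>n\<close>.  If \<open>n\<close> is large, two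
  prefixes agree in the products of the \<open>x\<^sub>i\<close>, of the \<open>c\<^sub>i\<close> and of the \<open>x\<^sub>i c\<^sub>i\<close>; all three
  products of the segment in between are trivial, so its \<open>x\<^sub>i\<close> can be removed.\<close>

lemma (in group) shuffle_values_shorten:
  assumes fin: "finite (carrier G)" and v: "set v \<subseteq> carrier G" and c: "set c \<subseteq> carrier G"
    and z: "z \<in> shuffle_values G v c" and long: "length v \<ge> card (carrier G) ^ 3"
  shows "\<exists>v'. length v' < length v \<and> set v' \<subseteq> carrier G \<and> shuffle_le G v' v
    \<and> z \<in> shuffle_values G v' c"
proof -
  let ?C = "carrier G"
  define V :: "('a \<times> 'a list) list \<Rightarrow> 'a list" where "V = map fst"
  define D :: "('a \<times> 'a list) list \<Rightarrow> 'a list" where "D ps = concat (map snd ps)" for ps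
  define W :: "('a \<times> 'a list) list \<Rightarrow> 'a list"
    where "W ps = concat (map (\<lambda>(x, d). x # d) ps)" for ps
  have append: "V (p @ q) = V p @ V q" "D (p @ q) = D p @ D q" "W (p @ q) = W p @ W q" for p q
    by (simp_all add: V_def D_def W_def)
  have W_shuffles: "W p \<in> shuffles (V p) (D p)" for p
    using blocks_in_shuffles[of p] by (simp add: V_def D_def W_def)
  from z obtain s where s: "s \<in> shuffles v c" "z = list_mult G s"
    by (auto simp: shuffle_values_def)
  from shuffles_blocks[OF s(1)] obtain c0 ps where
    ps: "s = c0 @ W ps" "v = V ps" "c = c0 @ D ps"
    unfolding V_def D_def W_def by blast
  have W_sub: "set (W p) \<subseteq> ?C" if "set (V p) \<subseteq> ?C" "set (D p) \<subseteq> ?C" for p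
    using set_shuffles[OF W_shuffles[of p]] that by simp
  define f where "f i = (list_mult G (V (take i ps)), list_mult G (D (take i ps)),
      list_mult G (W (take i ps)))" for i
  have "f i \<in> ?C \<times> ?C \<times> ?C" for i
  proof -
    have "set (V (take i ps)) \<subseteq> ?C" "set (D (take i ps)) \<subseteq> ?C"
      using v c append(1,2)[of "take i ps" "drop i ps"] ps by auto
    with W_sub show ?thesis by (simp add: f_def)
  qed
  then have "f ` {..length ps} \<subseteq> ?C \<times> ?C \<times> ?C" by blast
  then have "card (f ` {..length ps}) \<le> card (?C \<times> ?C \<times> ?C)"
    using fin by (intro card_mono) auto
  \<comment> \<open>There is one more prefix than there are blocks, so a length of exactly the
    number of triples already forces a collision.\<close>
  also have "\<dots> \<le> length ps"
    using long ps by (simp add: V_def card_cartesian_product power3_eq_cube)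
  finally have "\<not> inj_on f {..length ps}"
    using pigeonhole[of f "{..length ps}"] by auto
  then obtain i j where ij: "i < j" "j \<le> length ps" "f i = f j"
    unfolding inj_on_def by (metis atMost_iff linorder_neqE_nat)
  define a b d where "a = take i ps" and "b = drop i (take j ps)" and "d = drop j ps"
  have take_j: "take j ps = a @ b"
    unfolding a_def b_def using ij by (metis append_take_drop_id min.absorb1 nat_less_le take_take)
  then have split: "ps = a @ b @ d"
    unfolding d_def by (metis append.assoc append_take_drop_id)
  have "b \<noteq> []" using ij by (simp add: b_def)
  have VD_sub [simp]: "set (V a) \<subseteq> ?C" "set (D a) \<subseteq> ?C" "set (V b) \<subseteq> ?C" "set (D b) \<subseteq> ?C"
    "set (V d) \<subseteq> ?C" "set (D d) \<subseteq> ?C" "set c0 \<subseteq> ?C"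
    using v c ps by (auto simp: split append)
  have [simp]: "set (W a) \<subseteq> ?C" "set (W b) \<subseteq> ?C" "set (W d) \<subseteq> ?C"
    by (simp_all add: W_sub)
  have trivial: "list_mult G y = \<one>"
    if "list_mult G x = list_mult G (x @ y)" "set x \<subseteq> ?C" "set y \<subseteq> ?C" for x y
    using that by (metis l_cancel_one' list_mult_append list_mult_closed)
  have one: "list_mult G (V b) = \<one>" "list_mult G (D b) = \<one>" "list_mult G (W b) = \<one>"
  proof -
    have eq: "list_mult G (V a) = list_mult G (V a @ V b)"
      "list_mult G (D a) = list_mult G (D a @ D b)" "list_mult G (W a) = list_mult G (W a @ W b)"
      using ij(3) unfolding f_def a_def[symmetric] take_j append by simp_all
    show "list_mult G (V b) = \<one>" "list_mult G (D b) = \<one>" "list_mult G (W b) = \<one>"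
      using trivial[OF eq(1)] trivial[OF eq(2)] trivial[OF eq(3)] by simp_all
  qed
  \<comment> \<open>Only the letters of \<open>v\<close> leave the segment; those of the context
    stay, since the context must remain \<open>c\<close>. The value is unchanged because
    \<open>W b\<close> and \<open>D b\<close> both have product 1. That \<open>V b\<close> has
    product 1 serves the comparison with \<open>v\<close> further down.\<close>
  have "c0 @ W a @ D b @ W d \<in> shuffles ([] @ V a @ [] @ V d) (c0 @ D a @ D b @ D d)"
    by (intro append_in_shuffles_append W_shuffles) simp_all
  moreover have "list_mult G (c0 @ W a @ D b @ W d) = z"
    unfolding s(2) ps(1) split append
    by (simp add: list_mult_append one)
  ultimately have "z \<in> shuffle_values G (V a @ V d) c"
    by (auto simp: shuffle_values_def ps(3) split append)
  moreover have "shuffle_le G (V a @ V d) v"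
    unfolding shuffle_le_def ps(2) split append
    using shuffle_values_insert[of "V a" "V b" "V d"] one by auto
  moreover have "length (V a @ V d) < length v"
    using \<open>b \<noteq> []\<close> by (simp add: ps(2) split V_def)
  ultimately show ?thesis
    by (intro exI[of _ "V a @ V d"]) simp
qed

text \<open>Shortening is repeated for the same \<open>z\<close> and \<open>c\<close>, and
  \<open>shuffle_le\<close> is transitive. The resulting list depends on \<open>z\<close> and
  \<open>c\<close>, whereas its comparison with \<open>v\<close> holds in all contexts.\<close>

lemma (in group) shuffle_values_bounded:
  assumes fin: "finite (carrier G)" and v: "set v \<subseteq> carrier G" and c: "set c \<subseteq> carrier G"
    and z: "z \<in> shuffle_values G v c"
  shows "\<exists>v'. length v' \<le> card (carrier G) ^ 3 \<and> set v' \<subseteq> carrier G \<and> shuffle_le G v' v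
    \<and> z \<in> shuffle_values G v' c"
  using v z
proof (induction v rule: length_induct)
  case (1 v)
  show ?case
  proof (cases "length v \<le> card (carrier G) ^ 3")
    case True
    with 1(2,3) show ?thesis by (intro exI[of _ v]) (auto simp: shuffle_le_def)
  next
    case False
    with shuffle_values_shorten[OF fin 1(2) c 1(3)] obtain v' where
      "length v' < length v" "set v' \<subseteq> carrier G" "shuffle_le G v' v" "z \<in> shuffle_values G v' c"
      by auto
    with 1(1) show ?thesis unfolding shuffle_le_def by (meson subset_trans)
  qed
qed


section \<open>Linearizations of derivation trees\<close>

text \<open>The list of monoid elements collects the valences of the applied rules in order of
  application.\<close>

inductive lin :: "(nat \<times> sym list \<times> 'm) set \<Rightarrow> sym list \<Rightarrow> nat list \<Rightarrow> 'm list \<Rightarrow> bool"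
  for P where
  lin_Nil: "lin P [] [] []"
| lin_Inr: "lin P \<alpha> w u \<Longrightarrow> lin P (Inr a # \<alpha>) (a # w) u"
| lin_Inl: "(A, \<beta>, g) \<in> P \<Longrightarrow> lin P \<beta> w1 u1 \<Longrightarrow> lin P \<alpha> w2 u2 \<Longrightarrow> s \<in> shuffles (g # u1) u2 \<Longrightarrow>
    lin P (Inl A # \<alpha>) (w1 @ w2) s"

inductive_cases lin_InlE: "lin P (Inl A # \<alpha>) w s"
inductive_cases lin_InrE: "lin P (Inr a # \<alpha>) w s"

lemma lin_append:
  assumes "lin P \<alpha> w u" "lin P \<beta> w' u'" "s \<in> shuffles u u'"
  shows "lin P (\<alpha> @ \<beta>) (w @ w') s"
  using assms
proof (induction arbitrary: s)
  case (lin_Inl A \<gamma> g w1 u1 \<alpha> w2 u2 t)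
  then obtain y where "y \<in> shuffles u2 u'" "s \<in> shuffles (g # u1) y"
    using shuffles_assoc by metis
  with lin_Inl lin.lin_Inl[of A \<gamma> g P w1 u1 "\<alpha> @ \<beta>" "w2 @ w'" y s] show ?case by simp
qed (auto intro: lin.intros)

lemma lin_appendD:
  assumes "lin P (\<alpha> @ \<beta>) w s"
  shows "\<exists>w1 w2 u1 u2. w = w1 @ w2 \<and> lin P \<alpha> w1 u1 \<and> lin P \<beta> w2 u2 \<and> s \<in> shuffles u1 u2"
  using assms
proof (induction \<alpha> arbitrary: w s)
  case Nil
  then show ?case
    by (intro exI[of _ "[]"] exI[of _ w] exI[of _ s]) (auto intro: lin_Nil)
next
  case (Cons x \<alpha>)
  show ?case
  proof (cases x)
    case (Inl A)
    with Cons.prems obtain \<gamma> g w1 u1 w2 u2 where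
      *: "(A, \<gamma>, g) \<in> P" "lin P \<gamma> w1 u1" "lin P (\<alpha> @ \<beta>) w2 u2" "s \<in> shuffles (g # u1) u2"
      "w = w1 @ w2"
      by (auto elim: lin_InlE)
    from Cons.IH[OF *(3)] obtain w3 w4 u3 u4 where
      **: "w2 = w3 @ w4" "lin P \<alpha> w3 u3" "lin P \<beta> w4 u4" "u2 \<in> shuffles u3 u4" by blast
    obtain t where t: "t \<in> shuffles (g # u1) u3" "s \<in> shuffles t u4"
      using shuffles_assoc[of "g # u1" u3 s u4] *(4) **(4) by blast
    have "lin P (Inl A # \<alpha>) (w1 @ w3) t"
      by (rule lin_Inl[OF *(1,2) **(2) t(1)])
    with * ** t Inl show ?thesis
      by (metis append.assoc)
  next
    case (Inr a)
    with Cons.prems obtain w' where *: "w = a # w'" "lin P (\<alpha> @ \<beta>) w' s"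
      by (auto elim: lin_InrE)
    from Cons.IH[OF *(2)] Inr *(1) show ?thesis
      by (metis append_Cons lin_Inr)
  qed
qed

lemma lin_terminal: "lin P (map Inr w) w []"
  by (induction w) (auto intro: lin.intros)

text \<open>Every nonterminal contributes at least the valence of the rule applied to it.\<close>

lemma lin_empty: "lin P \<alpha> w [] \<Longrightarrow> \<alpha> = map Inr w"
  by (induction \<alpha> w "[] :: 'a list" rule: lin.induct) auto

text \<open>The valence of a root precedes everything in its own tree and may be scheduled before
  all other trees as well.\<close>

lemma lin_derive:
  assumes "lin P (w1 @ \<beta> @ w2) w u" "(A, \<beta>, g) \<in> P"
  shows "lin P (w1 @ [Inl A] @ w2) w (g # u)"
proof -
  from lin_appendD[OF assms(1)] obtain p1 p2 u1 u2 where
    *: "w = p1 @ p2" "lin P w1 p1 u1" "lin P (\<beta> @ w2) p2 u2" "u \<in> shuffles u1 u2" by blast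
  from lin_appendD[OF *(3)] obtain p3 p4 u3 u4 where
    **: "p2 = p3 @ p4" "lin P \<beta> p3 u3" "lin P w2 p4 u4" "u2 \<in> shuffles u3 u4" by blast
  have "lin P (Inl A # w2) (p3 @ p4) (g # u2)"
    by (rule lin_Inl[OF assms(2) **(2,3)]) (intro Cons_in_shuffles_leftI **)
  then show ?thesis
    using lin_append[OF *(2), of "Inl A # w2" p2 "g # u2" "g # u"] *(1,4) **(1)
    by (simp add: Cons_in_shuffles_rightI)
qed

text \<open>The first entry of a linearization has no predecessor in its tree, so it belongs to a
  root, and the rule at this root can be applied at once.\<close>

lemma lin_step:
  assumes "lin P \<alpha> w (g # u)"
  shows "\<exists>w1 A w2 \<beta>. \<alpha> = w1 @ [Inl A] @ w2 \<and> (A, \<beta>, g) \<in> P \<and> lin P (w1 @ \<beta> @ w2) w u"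
  using assms
proof (induction \<alpha> w "g # u" arbitrary: u rule: lin.induct)
  case (lin_Inr \<alpha> w a)
  then show ?case by (metis append_Cons lin.lin_Inr)
next
  case (lin_Inl A \<beta> h p1 u1 \<alpha> p2 u2)
  from lin_Inl.hyps(6) consider "h = g" "u \<in> shuffles u1 u2"
    | u2' where "u2 = g # u2'" "u \<in> shuffles (h # u1) u2'"
    by (auto simp: Cons_in_shuffles_iff neq_Nil_conv)
  then show ?case
  proof cases
    case 1
    with lin_Inl.hyps lin_append[OF lin_Inl.hyps(2,4) 1(2)] show ?thesis
      by (intro exI[of _ "[]"] exI[of _ A] exI[of _ \<alpha>] exI[of _ \<beta>]) auto
  next
    case 2
    from lin_Inl.hyps(5)[OF 2(1)] obtain w1 B w2 \<gamma> where
      *: "\<alpha> = w1 @ [Inl B] @ w2" "(B, \<gamma>, g) \<in> P" "lin P (w1 @ \<gamma> @ w2) p2 u2'" by blast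
    from * lin.lin_Inl[OF lin_Inl.hyps(1,2) *(3) 2(2)] show ?thesis
      by (intro exI[of _ "Inl A # w1"] exI[of _ B] exI[of _ w2] exI[of _ \<gamma>]) auto
  qed
qed

lemma lin_carrier:
  assumes "lin P \<alpha> w u" "\<forall>(A, \<beta>, g) \<in> P. g \<in> C"
  shows "set u \<subseteq> C"
  using assms by induction (auto simp: set_shuffles)

text \<open>Both directions peel off the first derivation step, which is the head of the
  linearization; this is why the initial value \<open>m\<close> is arbitrary.\<close>

lemma (in monoid) val_steps_iff_lin:
  assumes P: "\<forall>(A, \<beta>, g) \<in> P. g \<in> carrier G" and "m \<in> carrier G"
  shows "((\<alpha>, m), (map Inr w, m')) \<in> (val_step G P)\<^sup>* \<longleftrightarrow>
    (\<exists>u. lin P \<alpha> w u \<and> m' = m \<otimes> list_mult G u)"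
proof
  assume "((\<alpha>, m), (map Inr w, m')) \<in> (val_step G P)\<^sup>*"
  then show "\<exists>u. lin P \<alpha> w u \<and> m' = m \<otimes> list_mult G u"
    using \<open>m \<in> carrier G\<close>
  proof (induction \<alpha> m rule: converse_rtrancl_induct2)
    case refl
    then show ?case using lin_terminal[of P w] by (metis list_mult_Nil r_one)
  next
    case (step \<alpha> m \<alpha>' m1)
    from step.hyps(1) obtain w1 A w2 \<beta> n where
      *: "\<alpha> = w1 @ [Inl A] @ w2" "\<alpha>' = w1 @ \<beta> @ w2" "(A, \<beta>, n) \<in> P" "m1 = m \<otimes> n"
      by (auto simp: val_step_def)
    have n: "n \<in> carrier G" using P *(3) by auto
    with step * obtain u where u: "lin P \<alpha>' w u" "m' = m1 \<otimes> list_mult G u" by auto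
    have "set u \<subseteq> carrier G" by (rule lin_carrier[OF u(1) P])
    with u * n step.prems lin_derive[of P w1 \<beta> w2 w u A n] show ?case
      by (intro exI[of _ "n # u"]) (auto simp: m_assoc)
  qed
next
  assume "\<exists>u. lin P \<alpha> w u \<and> m' = m \<otimes> list_mult G u"
  then obtain u where "lin P \<alpha> w u" "m' = m \<otimes> list_mult G u" by blast
  then show "((\<alpha>, m), (map Inr w, m')) \<in> (val_step G P)\<^sup>*"
    using \<open>m \<in> carrier G\<close>
  proof (induction u arbitrary: \<alpha> m rule: list.induct)
    case Nil
    then show ?case by (auto dest: lin_empty)
  next
    case (Cons g u)
    from lin_step[OF Cons.prems(1)] obtain w1 A w2 \<beta> where
      *: "\<alpha> = w1 @ [Inl A] @ w2" "(A, \<beta>, g) \<in> P" "lin P (w1 @ \<beta> @ w2) w u" by blast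
    have g: "g \<in> carrier G" using P *(2) by auto
    have "set u \<subseteq> carrier G" by (rule lin_carrier[OF *(3) P])
    then have "((w1 @ \<beta> @ w2, m \<otimes> g), (map Inr w, m')) \<in> (val_step G P)\<^sup>*"
      using Cons.prems g by (intro Cons.IH[OF *(3)]) (auto simp: m_assoc)
    moreover have "((\<alpha>, m), (w1 @ \<beta> @ w2, m \<otimes> g)) \<in> val_step G P"
      using * unfolding val_step_def by blast
    ultimately show ?case by (rule converse_rtrancl_into_rtrancl[rotated])
  qed
qed

lemma (in monoid) val_lang_eq_lin:
  assumes "\<forall>(A, \<beta>, g) \<in> P. g \<in> carrier G"
  shows "val_lang G T P S = {w. set w \<subseteq> T \<and> (\<exists>u. lin P [Inl S] w u \<and> list_mult G u = \<one>)}"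
proof -
  have "\<one> \<otimes> list_mult G u = list_mult G u" if "lin P [Inl S] w u" for w u
    using lin_carrier[OF that assms] by auto
  then show ?thesis
    unfolding val_lang_def val_steps_iff_lin[OF assms one_closed] by metis
qed


section \<open>Trivial valences\<close>

text \<open>A context-free grammar is read as a valence grammar with trivial valences, so that
  \<open>lin\<close> describes the trees of both grammars to be compared.\<close>

definition unit_rules :: "('m, 'x) monoid_scheme \<Rightarrow> (nat \<times> sym list) set \<Rightarrow> (nat \<times> sym list \<times> 'm) set"
  where "unit_rules G P = (\<lambda>(A, \<alpha>). (A, \<alpha>, \<one>\<^bsub>G\<^esub>)) ` P"

lemma (in monoid) val_lang_unit_rules:
  "val_lang G T (unit_rules G P) S = cf_lang T P S"
proof -
  have "((x, \<one>), (y, m)) \<in> (val_step G (unit_rules G P))\<^sup>* \<longleftrightarrow> m = \<one> \<and> (x, y) \<in> (cf_step P)\<^sup>*"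
    for x y m
  proof
    assume "((x, \<one>), (y, m)) \<in> (val_step G (unit_rules G P))\<^sup>*"
    then show "m = \<one> \<and> (x, y) \<in> (cf_step P)\<^sup>*"
    proof (induction y m rule: rtrancl_induct2)
      case (step y m y' m')
      then have "m' = \<one> \<and> (y, y') \<in> cf_step P"
        by (auto simp: val_step_def cf_step_def unit_rules_def)
      with step show ?case by (auto intro: rtrancl_into_rtrancl)
    qed simp
  next
    assume *: "m = \<one> \<and> (x, y) \<in> (cf_step P)\<^sup>*"
    then have "(x, y) \<in> (cf_step P)\<^sup>*" by simp
    then have "((x, \<one>), (y, \<one>)) \<in> (val_step G (unit_rules G P))\<^sup>*"
    proof (induction rule: rtrancl_induct)
      case (step y y')
      then obtain w1 w2 A \<alpha> where
        "y = w1 @ [Inl A] @ w2" "y' = w1 @ \<alpha> @ w2" "(A, \<alpha>) \<in> P"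
        by (auto simp: cf_step_def)
      moreover from this have "(A, \<alpha>, \<one>) \<in> unit_rules G P" by (force simp: unit_rules_def)
      ultimately have "((y, \<one>), (y', \<one>)) \<in> val_step G (unit_rules G P)"
        unfolding val_step_def using r_one[OF one_closed] by (simp, metis)
      with step.IH show ?case by (rule rtrancl_into_rtrancl)
    qed simp
    with * show "((x, \<one>), (y, m)) \<in> (val_step G (unit_rules G P))\<^sup>*" by simp
  qed
  then show ?thesis by (simp add: val_lang_def cf_lang_def)
qed

lemma (in monoid) CFL_subset_LValCF: "CFL \<subseteq> LValCF G"
proof
  fix L assume "L \<in> CFL"
  then obtain V T P S where *: "cf_grammar V T P S" "L = cf_lang T P S" by (auto simp: CFL_def)
  then have "val_grammar G V T (unit_rules G P) S"
    by (auto simp: cf_grammar_def val_grammar_def unit_rules_def)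
  moreover have "L = val_lang G T (unit_rules G P) S"
    using * by (simp add: val_lang_unit_rules)
  ultimately show "L \<in> LValCF G" unfolding LValCF_def by blast
qed


section \<open>Finite groups\<close>

text \<open>A nonterminal is paired with the profile guessed for its subtree. Since grammars number
  nonterminals by \<open>nat\<close>, \<open>encode\<close> maps such forms back to
  \<open>sym list\<close>, while \<open>forget\<close> recovers the original form.\<close>

type_synonym 'm psym = "(nat \<times> 'm list) + nat"

abbreviation forget :: "'m psym list \<Rightarrow> sym list" where
  "forget \<equiv> map (map_sum fst (\<lambda>a. a))"

abbreviation encode :: "(nat \<times> 'm list \<Rightarrow> nat) \<Rightarrow> 'm psym list \<Rightarrow> sym list" where
  "encode e \<equiv> map (map_sum e (\<lambda>a. a))"

text \<open>This is the counterpart of \<open>lin\<close> for a forest in which each tree is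
  represented by its profile alone.\<close>

fun profile_shuffles :: "'m psym list \<Rightarrow> 'm list set" where
  "profile_shuffles [] = {[]}"
| "profile_shuffles (Inl (A, v) # \<beta>) = (\<Union>x \<in> profile_shuffles \<beta>. shuffles v x)"
| "profile_shuffles (Inr a # \<beta>) = profile_shuffles \<beta>"

definition profiles :: "('m, 'x) monoid_scheme \<Rightarrow> 'm list set" where
  "profiles G = {v. set v \<subseteq> carrier G \<and> length v \<le> card (carrier G) ^ 3}"

text \<open>The profile \<open>v\<close> promises nothing that a rule of valence \<open>g\<close>, followed by subtrees with the
  profiles in \<open>\<beta>\<close>, cannot deliver.\<close>

definition profile_rule ::
  "('m, 'x) monoid_scheme \<Rightarrow> 'm \<Rightarrow> 'm psym list \<Rightarrow> 'm list \<Rightarrow> bool" where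
  "profile_rule G g \<beta> v \<longleftrightarrow> (\<forall>c. set c \<subseteq> carrier G \<longrightarrow>
     shuffle_values G v c \<subseteq> (\<Union>y \<in> profile_shuffles \<beta>. shuffle_values G (g # y) c))"

text \<open>Injectivity of \<open>e\<close> is asked on a finite set only, because the type of lists
  over the group need not embed into \<open>nat\<close>.\<close>

locale finite_valence_grammar = group G for G :: "('m, 'x) monoid_scheme" (structure) +
  fixes V T :: "nat set" and P :: "(nat \<times> sym list \<times> 'm) set" and S :: nat
    and e :: "nat \<times> 'm list \<Rightarrow> nat"
  assumes fin: "finite (carrier G)"
    and grammar: "val_grammar G V T P S"
    and inj_e: "inj_on e (V \<times> profiles G)"
begin

definition psyms :: "'m psym set" where
  "psyms = Inl ` (V \<times> profiles G) \<union> Inr ` T"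

text \<open>The valence disappears from the rule: its effect is absorbed by the condition relating
  the profile on the left to those on the right.\<close>

definition prules :: "(nat \<times> sym list) set" where
  "prules = {(e (A, v), encode e \<beta>) | A v \<beta>. A \<in> V \<and> v \<in> profiles G \<and> set \<beta> \<subseteq> psyms \<and>
     (\<exists>g. (A, forget \<beta>, g) \<in> P \<and> profile_rule G g \<beta> v)}"

lemma P_carrier: "\<forall>(A, \<beta>, g) \<in> P. g \<in> carrier G"
  using grammar by (auto simp: val_grammar_def)

lemma finite_profiles: "finite (profiles G)"
  unfolding profiles_def by (rule finite_lists_length_le[OF fin])

lemma profile_shuffles_carrier:
  assumes "set \<beta> \<subseteq> psyms" "x \<in> profile_shuffles \<beta>"
  shows "set x \<subseteq> carrier G"
  using assms
proof (induction \<beta> arbitrary: x rule: profile_shuffles.induct)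
  case (2 A v \<beta>)
  then obtain y where y: "y \<in> profile_shuffles \<beta>" "x \<in> shuffles v y" by auto
  moreover have "set v \<subseteq> carrier G" using 2(2) by (auto simp: psyms_def profiles_def)
  ultimately show ?case using 2(1)[OF _ y(1)] 2(2) set_shuffles[OF y(2)] by simp
qed auto

text \<open>Profiles are replaced by actual linearizations from the outside in, keeping the value
  \<open>z\<close>. Context and value are arbitrary in the induction because each subtree is treated
  with everything else, partly still in the form of profiles, as its context.\<close>

lemma lin_prules_sound:
  assumes "lin (unit_rules G prules) (encode e \<beta>) w s" "set \<beta> \<subseteq> psyms" "set c \<subseteq> carrier G"
    "x \<in> profile_shuffles \<beta>" "z \<in> shuffle_values G x c"
  shows "\<exists>u. lin P (forget \<beta>) w u \<and> z \<in> shuffle_values G u c"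
  using assms
proof (induction "encode e \<beta>" w s arbitrary: \<beta> c x z rule: lin.induct)
  case lin_Nil
  then show ?case by (intro exI[of _ "[]"]) (auto intro: lin.lin_Nil)
next
  case (lin_Inr \<alpha> w u a)
  from lin_Inr.hyps(3) obtain \<beta>' where "\<beta> = Inr a # \<beta>'" "\<alpha> = encode e \<beta>'"
    by (cases \<beta>; cases "hd \<beta>") auto
  with lin_Inr.hyps(2)[of \<beta>' c x z] lin_Inr.prems show ?case
    by (auto intro: lin.lin_Inr)
next
  case (lin_Inl B \<gamma> h w1 u1 \<alpha> w2 u2 s)
  from lin_Inl.hyps(7) obtain A v \<beta>' where
    \<beta>: "\<beta> = Inl (A, v) # \<beta>'" "B = e (A, v)" "\<alpha> = encode e \<beta>'"
    by (cases \<beta>; cases "hd \<beta>") auto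
  from lin_Inl.hyps(1) obtain A' v' \<delta> g where
    "B = e (A', v')" and \<delta>: "\<gamma> = encode e \<delta>" "A' \<in> V" "v' \<in> profiles G" "set \<delta> \<subseteq> psyms"
    "(A', forget \<delta>, g) \<in> P" "profile_rule G g \<delta> v'"
    unfolding unit_rules_def prules_def by auto
  moreover have "A \<in> V" "v \<in> profiles G"
    using lin_Inl.prems(1) \<beta> by (auto simp: psyms_def)
  ultimately have [simp]: "A' = A" "v' = v"
    using inj_e \<beta>(2) by (auto dest: inj_onD)
  have \<beta>': "set \<beta>' \<subseteq> psyms" using lin_Inl.prems(1) \<beta> by auto
  have g: "g \<in> carrier G" using P_carrier \<delta>(5) by auto
  from lin_Inl.prems(3) \<beta> obtain x' where x': "x' \<in> profile_shuffles \<beta>'" "x \<in> shuffles v x'"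
    by auto
  obtain c1 where c1: "c1 \<in> shuffles x' c" "z \<in> shuffle_values G v c1"
    using shuffle_values_assoc[of v x' z G c] x'(2) lin_Inl.prems(4) by blast
  have c1_carrier: "set c1 \<subseteq> carrier G"
    using set_shuffles[OF c1(1)] profile_shuffles_carrier[OF \<beta>' x'(1)] lin_Inl.prems(2) by auto
  \<comment> \<open>The local check on the rule is used here: the profile of the head is traded for
    the valence \<open>g\<close> and the profiles on the right-hand side.\<close>
  then obtain y where y: "y \<in> profile_shuffles \<delta>" "z \<in> shuffle_values G (g # y) c1"
    using \<delta>(6) c1(2) unfolding profile_rule_def by simp blast
  from y(2) obtain c2 c3 z' where
    c3: "c1 = c2 @ c3" "z' \<in> shuffle_values G y c3" "z = list_mult G c2 \<otimes> (g \<otimes> z')"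
    unfolding shuffle_values_Cons[OF g profile_shuffles_carrier[OF \<delta>(4) y(1)] c1_carrier] by blast
  from lin_Inl.hyps(3)[OF \<delta>(1) \<delta>(4) _ y(1) c3(2)] c3(1) c1_carrier obtain u where
    u: "lin P (forget \<delta>) w1 u" "z' \<in> shuffle_values G u c3" by auto
  have u_carrier: "set u \<subseteq> carrier G" by (rule lin_carrier[OF u(1) P_carrier])
  have "z \<in> shuffle_values G (g # u) c1"
    using c3 u(2) unfolding shuffle_values_Cons[OF g u_carrier c1_carrier] by blast
  with c1(1) have "\<exists>t \<in> shuffles (g # u) x'. z \<in> shuffle_values G t c"
    unfolding shuffle_values_assoc by blast
  \<comment> \<open>The roles swap: the realized head tree \<open>g # u\<close> joins the context,
    and the profiles of the siblings become the list to be realized.\<close>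
  then obtain c4 where c4: "c4 \<in> shuffles (g # u) c" "z \<in> shuffle_values G x' c4"
    unfolding shuffle_values_assoc' by blast
  have "set c4 \<subseteq> carrier G"
    using set_shuffles[OF c4(1)] g u_carrier lin_Inl.prems(2) by auto
  from lin_Inl.hyps(5)[OF \<beta>(3) \<beta>' this x'(1) c4(2)] obtain u' where
    u': "lin P (forget \<beta>') w2 u'" "z \<in> shuffle_values G u' c4" by blast
  then obtain t where t: "t \<in> shuffles (g # u) u'" "z \<in> shuffle_values G t c"
    using shuffle_values_assoc'[of "g # u" u' z G c] c4(1) by blast
  have "lin P (forget \<beta>) (w1 @ w2) t"
    using lin.lin_Inl[OF \<delta>(5) u(1) u'(1) t(1)] \<beta>(1) by simp
  with t(2) show ?case by blast
qed

text \<open>Actual linearizations are replaced by profiles with the value \<open>z\<close> kept. The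
  profile of a node is chosen after those of its children, for the context formed by
  \<open>c\<close> and the siblings.\<close>

lemma lin_prules_complete:
  assumes "lin P \<alpha> w u" "set \<alpha> \<subseteq> Inl ` V \<union> Inr ` T" "set c \<subseteq> carrier G"
    "z \<in> shuffle_values G u c"
  shows "\<exists>\<beta> s. set \<beta> \<subseteq> psyms \<and> forget \<beta> = \<alpha> \<and> lin (unit_rules G prules) (encode e \<beta>) w s \<and>
    (\<exists>x \<in> profile_shuffles \<beta>. z \<in> shuffle_values G x c)"
  using assms
proof (induction arbitrary: c z rule: lin.induct)
  case lin_Nil
  then show ?case by (intro exI[of _ "[]"]) (auto intro: lin.lin_Nil)
next
  case (lin_Inr \<alpha> w u a)
  then have "set \<alpha> \<subseteq> Inl ` V \<union> Inr ` T" by auto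
  from lin_Inr.IH[OF this lin_Inr.prems(2,3)] obtain \<beta> s where
    "set \<beta> \<subseteq> psyms" "forget \<beta> = \<alpha>" "lin (unit_rules G prules) (encode e \<beta>) w s"
    "\<exists>x \<in> profile_shuffles \<beta>. z \<in> shuffle_values G x c"
    by blast
  with lin_Inr.prems show ?case
    by (intro exI[of _ "Inr a # \<beta>"] exI[of _ s]) (auto simp: psyms_def intro: lin.lin_Inr)
next
  case (lin_Inl A \<gamma> g w1 u1 \<alpha> w2 u2 s)
  have A: "A \<in> V" and g: "g \<in> carrier G" and \<gamma>: "set \<gamma> \<subseteq> Inl ` V \<union> Inr ` T"
    using grammar lin_Inl.hyps(1) by (auto simp: val_grammar_def)
  have u1: "set u1 \<subseteq> carrier G" and u2: "set u2 \<subseteq> carrier G"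
    by (rule lin_carrier[OF lin_Inl.hyps(2) P_carrier], rule lin_carrier[OF lin_Inl.hyps(3) P_carrier])
  obtain c1 where c1: "c1 \<in> shuffles u2 c" "z \<in> shuffle_values G (g # u1) c1"
    using shuffle_values_assoc[of "g # u1" u2 z G c] lin_Inl.hyps(4) lin_Inl.prems(3) by blast
  have c1_carrier: "set c1 \<subseteq> carrier G"
    using set_shuffles[OF c1(1)] u2 lin_Inl.prems(2) by auto
  from c1(2) obtain c2 c3 z' where
    c3: "c1 = c2 @ c3" "z' \<in> shuffle_values G u1 c3" "z = list_mult G c2 \<otimes> (g \<otimes> z')"
    unfolding shuffle_values_Cons[OF g u1 c1_carrier] by blast
  have "set c3 \<subseteq> carrier G" using c3(1) c1_carrier by simp
  from lin_Inl.IH(1)[OF \<gamma> this c3(2)] obtain \<delta> s1 y where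
    \<delta>: "set \<delta> \<subseteq> psyms" "forget \<delta> = \<gamma>" "lin (unit_rules G prules) (encode e \<delta>) w1 s1"
    "y \<in> profile_shuffles \<delta>" "z' \<in> shuffle_values G y c3"
    by blast
  have y: "set y \<subseteq> carrier G" by (rule profile_shuffles_carrier[OF \<delta>(1,4)])
  have "z \<in> shuffle_values G (g # y) c1"
    using c3 \<delta>(5) unfolding shuffle_values_Cons[OF g y c1_carrier] by blast
  \<comment> \<open>What is compressed is \<open>g # y\<close>, built from the profiles of the
    children, and not \<open>g # u1\<close>: the rule has to be justified by the annotations it
    contains.\<close>
  from shuffle_values_bounded[OF fin _ c1_carrier this] g y obtain v where
    v: "v \<in> profiles G" "shuffle_le G v (g # y)" "z \<in> shuffle_values G v c1"
    by (auto simp: profiles_def)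
  have "profile_rule G g \<delta> v"
    using v(2) \<delta>(4) unfolding profile_rule_def shuffle_le_def by blast
  then have "(e (A, v), encode e \<delta>) \<in> prules"
    using A v(1) \<delta>(1,2) lin_Inl.hyps(1) unfolding prules_def by blast
  then have rule: "(e (A, v), encode e \<delta>, \<one>) \<in> unit_rules G prules"
    by (force simp: unit_rules_def)
  from c1(1) v(3) have "\<exists>t \<in> shuffles v u2. z \<in> shuffle_values G t c"
    unfolding shuffle_values_assoc by blast
  \<comment> \<open>The siblings are annotated next, with the head tree present in their context
    only through its profile \<open>v\<close>.\<close>
  then obtain c4 where c4: "c4 \<in> shuffles v c" "z \<in> shuffle_values G u2 c4"
    unfolding shuffle_values_assoc' by blast
  have "set c4 \<subseteq> carrier G"
    using set_shuffles[OF c4(1)] v(1) lin_Inl.prems(2) by (auto simp: profiles_def)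
  moreover have "set \<alpha> \<subseteq> Inl ` V \<union> Inr ` T" using lin_Inl.prems(1) by simp
  ultimately obtain \<beta> s2 x where
    \<beta>: "set \<beta> \<subseteq> psyms" "forget \<beta> = \<alpha>" "lin (unit_rules G prules) (encode e \<beta>) w2 s2"
    "x \<in> profile_shuffles \<beta>" "z \<in> shuffle_values G x c4"
    using lin_Inl.IH(2)[OF _ _ c4(2)] by blast
  obtain t where "t \<in> shuffles v x" "z \<in> shuffle_values G t c"
    using shuffle_values_assoc'[of v x z G c] c4(1) \<beta>(5) by blast
  moreover have "lin (unit_rules G prules) (encode e (Inl (A, v) # \<beta>)) (w1 @ w2) ((\<one> # s1) @ s2)"
    using lin.lin_Inl[OF rule \<delta>(3) \<beta>(3) append_in_shuffles] by simp
  ultimately show ?case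
    using \<beta> A v(1) by (intro exI[of _ "Inl (A, v) # \<beta>"]) (auto simp: psyms_def)
qed

text \<open>Hence the empty profile can serve as the one of the start symbol.\<close>

lemma prules_start:
  assumes v: "v \<in> profiles G" "list_mult G v = \<one>" and A: "A \<in> V"
    and "(e (A, v), \<gamma>) \<in> prules"
  shows "(e (A, []), \<gamma>) \<in> prules"
proof -
  from assms(4) obtain A' v' \<beta> g where
    *: "e (A, v) = e (A', v')" "\<gamma> = encode e \<beta>" "A' \<in> V" "v' \<in> profiles G" "set \<beta> \<subseteq> psyms"
    "(A', forget \<beta>, g) \<in> P" "profile_rule G g \<beta> v'"
    unfolding prules_def by auto
  have [simp]: "A' = A" "v' = v"
    using inj_onD[OF inj_e *(1)] *(3,4) v(1) A by auto
  have "shuffle_values G [] c \<subseteq> shuffle_values G v c" if "set c \<subseteq> carrier G" for c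
    using shuffle_values_insert[of "[]" v "[]" c] v that by (auto simp: profiles_def)
  then have "profile_rule G g \<beta> []"
    using *(7) unfolding profile_rule_def \<open>v' = v\<close> by (meson order_trans)
  moreover have "[] \<in> profiles G" by (simp add: profiles_def)
  ultimately show ?thesis using *(2,5,6) A unfolding prules_def \<open>A' = A\<close> by blast
qed

text \<open>At the root the context is empty, so a profile has only its own product as value. A
  derivation with value 1 thus annotates \<open>S\<close> with some \<open>v\<close> of product 1,
  which may be exchanged for \<open>[]\<close>. Conversely, \<open>[]\<close> has value 1 in the
  empty context, and soundness supplies a derivation with this value.\<close>

lemma val_lang_eq_cf_lang: "val_lang G T P S = cf_lang T prules (e (S, []))"
proof -
  have S: "S \<in> V" using grammar by (simp add: val_grammar_def)
  have Nil: "[] \<in> profiles G" by (simp add: profiles_def)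
  have unit: "\<forall>(A, \<beta>, g) \<in> unit_rules G prules. g \<in> carrier G" by (auto simp: unit_rules_def)
  \<comment> \<open>On the context-free side all valences are 1, so the condition on the product
    holds for every linearization.\<close>
  have unit_mult: "list_mult G s = \<one>" if "set s \<subseteq> {\<one>}" for s
    using that by (induction s) auto
  have "(\<exists>u. lin P [Inl S] w u \<and> list_mult G u = \<one>) \<longleftrightarrow>
      (\<exists>s. lin (unit_rules G prules) [Inl (e (S, []))] w s \<and> list_mult G s = \<one>)" for w
  proof
    assume "\<exists>u. lin P [Inl S] w u \<and> list_mult G u = \<one>"
    then obtain u where u: "lin P [Inl S] w u" "\<one> \<in> shuffle_values G u []" by auto
    have "set [Inl S] \<subseteq> Inl ` V \<union> Inr ` T" "set [] \<subseteq> carrier G" using S by auto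
    from lin_prules_complete[OF u(1) this u(2)] obtain \<beta> s x where
      \<beta>: "set \<beta> \<subseteq> psyms" "forget \<beta> = [Inl S]" "lin (unit_rules G prules) (encode e \<beta>) w s"
      "x \<in> profile_shuffles \<beta>" "\<one> \<in> shuffle_values G x []"
      by (elim exE conjE bexE) (rule that)
    from \<beta>(2) obtain y where y: "\<beta> = [y]" "map_sum fst (\<lambda>a. a) y = Inl S" by auto
    then obtain v where v: "\<beta> = [Inl (S, v)]" by (cases y) auto
    have v': "v \<in> profiles G" "list_mult G v = \<one>"
      using \<beta>(1,4,5) unfolding v shuffle_values_Nil by (simp_all add: psyms_def image_iff)
    from \<beta>(3) have "lin (unit_rules G prules) [Inl (e (S, v))] w s" by (simp add: v)
    then obtain \<gamma> g w1 u1 w2 u2 where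
      *: "(e (S, v), \<gamma>, g) \<in> unit_rules G prules" "lin (unit_rules G prules) \<gamma> w1 u1"
      "lin (unit_rules G prules) [] w2 u2" "s \<in> shuffles (g # u1) u2" "w = w1 @ w2"
      by (rule lin_InlE) (rule that)
    then have "(e (S, []), \<gamma>, g) \<in> unit_rules G prules"
      using prules_start[OF v' S, of \<gamma>] by (auto simp: unit_rules_def)
    from lin.lin_Inl[OF this *(2-4)] *(5)
    have "lin (unit_rules G prules) [Inl (e (S, []))] w s" by simp
    moreover have "set s \<subseteq> {\<one>}"
      by (rule lin_carrier[OF \<beta>(3)]) (auto simp: unit_rules_def)
    ultimately show "\<exists>s. lin (unit_rules G prules) [Inl (e (S, []))] w s \<and> list_mult G s = \<one>"
      using unit_mult by blast
  next
    assume "\<exists>s. lin (unit_rules G prules) [Inl (e (S, []))] w s \<and> list_mult G s = \<one>"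
    then obtain s where "lin (unit_rules G prules) (encode e [Inl (S, [])]) w s" by auto
    from lin_prules_sound[OF this, of "[]" "[]" \<one>] S Nil
    show "\<exists>u. lin P [Inl S] w u \<and> list_mult G u = \<one>"
      by (simp add: psyms_def image_iff) metis
  qed
  then show ?thesis
    unfolding val_lang_unit_rules[symmetric] val_lang_eq_lin[OF P_carrier] val_lang_eq_lin[OF unit]
    by simp
qed

lemma cf_grammar_prules: "cf_grammar (e ` (V \<times> profiles G)) T prules (e (S, []))"
proof -
  have fins: "finite V" "finite T" "finite P" "S \<in> V" using grammar by (auto simp: val_grammar_def)
  \<comment> \<open>Annotating a right-hand side preserves its length, so \<open>n\<close> also
    bounds the new rules. For empty \<open>P\<close> the maximum is unspecified, but the bound is
    claimed only for members of \<open>P\<close>.\<close>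
  define n where "n = Max ((\<lambda>(A, \<alpha>, g). length \<alpha>) ` P)"
  have n: "length \<alpha> \<le> n" if "(A, \<alpha>, g) \<in> P" for A \<alpha> g
    unfolding n_def using fins(3) that by (intro Max_ge) force+
  have "prules \<subseteq> (\<lambda>(A, v, \<beta>). (e (A, v), encode e \<beta>)) `
      (V \<times> profiles G \<times> {\<beta>. set \<beta> \<subseteq> psyms \<and> length \<beta> \<le> n})"
  proof
    fix r assume "r \<in> prules"
    then obtain A v \<beta> g where r: "r = (e (A, v), encode e \<beta>)" "A \<in> V" "v \<in> profiles G"
      "set \<beta> \<subseteq> psyms" "(A, forget \<beta>, g) \<in> P"
      unfolding prules_def by blast
    from n[OF r(5)] have "length \<beta> \<le> n" by simp
    with r show "r \<in> (\<lambda>(A, v, \<beta>). (e (A, v), encode e \<beta>)) `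
      (V \<times> profiles G \<times> {\<beta>. set \<beta> \<subseteq> psyms \<and> length \<beta> \<le> n})"
      by (intro image_eqI[of _ _ "(A, v, \<beta>)"]) simp_all
  qed
  moreover have "finite psyms" using fins finite_profiles by (simp add: psyms_def)
  ultimately have "finite prules"
    using fins finite_profiles
    by (elim finite_subset) (intro finite_imageI finite_SigmaI finite_lists_length_le)
  moreover have "B \<in> e ` (V \<times> profiles G) \<and> set \<gamma> \<subseteq> Inl ` e ` (V \<times> profiles G) \<union> Inr ` T"
    if "(B, \<gamma>) \<in> prules" for B \<gamma>
  proof -
    from that obtain A v \<beta> where r: "B = e (A, v)" "\<gamma> = encode e \<beta>" "A \<in> V" "v \<in> profiles G"
      "set \<beta> \<subseteq> psyms"
      unfolding prules_def by blast
    then have "set \<gamma> \<subseteq> map_sum e (\<lambda>a. a) ` psyms" by auto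
    also have "\<dots> \<subseteq> Inl ` e ` (V \<times> profiles G) \<union> Inr ` T"
      by (auto simp: psyms_def)
    finally show ?thesis using r by blast
  qed
  moreover have "[] \<in> profiles G" by (simp add: profiles_def)
  ultimately show ?thesis
    using fins finite_profiles by (auto simp: cf_grammar_def)
qed

end

lemma (in group) finite_LValCF_subset_CFL:
  assumes "finite (carrier G)"
  shows "LValCF G \<subseteq> CFL"
proof
  fix L assume "L \<in> LValCF G"
  then obtain V T P S where *: "val_grammar G V T P S" "L = val_lang G T P S"
    by (auto simp: LValCF_def)
  have "finite (V \<times> profiles G)"
    using * finite_lists_length_le[OF assms] by (auto simp: val_grammar_def profiles_def)
  then obtain e :: "nat \<times> 'a list \<Rightarrow> nat" where "inj_on e (V \<times> profiles G)"
    using finite_imp_inj_to_nat_seg by blast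
  then interpret finite_valence_grammar G V T P S e
    using assms * by unfold_locales auto
  show "L \<in> CFL"
    using * val_lang_eq_cf_lang cf_grammar_prules unfolding CFL_def by blast
qed


section \<open>Change of monoid\<close>

text \<open>Every value reached with the mapped rules is the image of a value reached by the same
  steps over \<open>N\<close>. Acceptance compares only with 1, so it is enough that
  \<open>h\<close> sends nothing else to 1.\<close>

lemma val_lang_hom:
  assumes "monoid M" "monoid N" and h: "h \<in> hom N M" "h \<one>\<^bsub>N\<^esub> = \<one>\<^bsub>M\<^esub>"
    and ker: "\<And>x. x \<in> carrier N \<Longrightarrow> h x = \<one>\<^bsub>M\<^esub> \<Longrightarrow> x = \<one>\<^bsub>N\<^esub>"
    and P: "\<forall>(A, \<alpha>, n) \<in> P. n \<in> carrier N"
  shows "val_lang N T P S = val_lang M T ((\<lambda>(A, \<alpha>, n). (A, \<alpha>, h n)) ` P) S"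
    (is "_ = val_lang M T ?Q S")
proof -
  interpret M: monoid M by fact
  interpret N: monoid N by fact
  have "((x, \<one>\<^bsub>M\<^esub>), (y, m)) \<in> (val_step M ?Q)\<^sup>* \<longleftrightarrow>
      (\<exists>n \<in> carrier N. m = h n \<and> ((x, \<one>\<^bsub>N\<^esub>), (y, n)) \<in> (val_step N P)\<^sup>*)" for x y m
  proof
    assume "((x, \<one>\<^bsub>M\<^esub>), (y, m)) \<in> (val_step M ?Q)\<^sup>*"
    then show "\<exists>n \<in> carrier N. m = h n \<and> ((x, \<one>\<^bsub>N\<^esub>), (y, n)) \<in> (val_step N P)\<^sup>*"
    proof (induction y m rule: rtrancl_induct2)
      case refl
      then show ?case using h(2) by (intro bexI[of _ "\<one>\<^bsub>N\<^esub>"]) auto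
    next
      case (step y m y' m')
      then obtain n where n: "n \<in> carrier N" "m = h n" "((x, \<one>\<^bsub>N\<^esub>), (y, n)) \<in> (val_step N P)\<^sup>*"
        by blast
      from step.hyps(2) obtain w1 A w2 \<alpha> k where
        *: "y = w1 @ [Inl A] @ w2" "y' = w1 @ \<alpha> @ w2" "(A, \<alpha>, k) \<in> P" "m' = m \<otimes>\<^bsub>M\<^esub> h k"
        by (auto simp: val_step_def)
      then have "((y, n), (y', n \<otimes>\<^bsub>N\<^esub> k)) \<in> val_step N P"
        unfolding val_step_def by blast
      with n(3) have "((x, \<one>\<^bsub>N\<^esub>), (y', n \<otimes>\<^bsub>N\<^esub> k)) \<in> (val_step N P)\<^sup>*"
        by (rule rtrancl_into_rtrancl)
      moreover have "k \<in> carrier N" using P *(3) by auto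
      ultimately show ?case
        using n *(4) hom_mult[OF h(1)] by (intro bexI[of _ "n \<otimes>\<^bsub>N\<^esub> k"]) auto
    qed
  next
    assume "\<exists>n \<in> carrier N. m = h n \<and> ((x, \<one>\<^bsub>N\<^esub>), (y, n)) \<in> (val_step N P)\<^sup>*"
    then obtain n where n: "m = h n" "((x, \<one>\<^bsub>N\<^esub>), (y, n)) \<in> (val_step N P)\<^sup>*" by blast
    from n(2) have "n \<in> carrier N \<and> ((x, \<one>\<^bsub>M\<^esub>), (y, h n)) \<in> (val_step M ?Q)\<^sup>*"
    proof (induction y n rule: rtrancl_induct2)
      case refl
      then show ?case using h(2) by auto
    next
      case (step y n y' n')
      from step.hyps(2) obtain w1 A w2 \<alpha> k where
        *: "y = w1 @ [Inl A] @ w2" "y' = w1 @ \<alpha> @ w2" "(A, \<alpha>, k) \<in> P" "n' = n \<otimes>\<^bsub>N\<^esub> k"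
        by (auto simp: val_step_def)
      have k: "k \<in> carrier N" using P *(3) by auto
      have "(A, \<alpha>, h k) \<in> ?Q" using *(3) by force
      then have "((y, h n), (y', h n \<otimes>\<^bsub>M\<^esub> h k)) \<in> val_step M ?Q"
        using *(1,2) unfolding val_step_def by blast
      with step.IH k *(4) show ?case
        using hom_mult[OF h(1)] by (auto intro: rtrancl_into_rtrancl)
    qed
    with n(1) show "((x, \<one>\<^bsub>M\<^esub>), (y, m)) \<in> (val_step M ?Q)\<^sup>*" by simp
  qed
  then show ?thesis
    unfolding val_lang_def using ker h(2) N.one_closed by (metis (no_types, lifting))
qed

lemma LValCF_subset_hom:
  assumes "monoid M" "monoid N" and h: "h \<in> hom N M" "h \<one>\<^bsub>N\<^esub> = \<one>\<^bsub>M\<^esub>"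
    and ker: "\<And>x. x \<in> carrier N \<Longrightarrow> h x = \<one>\<^bsub>M\<^esub> \<Longrightarrow> x = \<one>\<^bsub>N\<^esub>"
  shows "LValCF N \<subseteq> LValCF M"
proof
  fix L assume "L \<in> LValCF N"
  then obtain V T P S where *: "val_grammar N V T P S" "L = val_lang N T P S"
    by (auto simp: LValCF_def)
  have "val_grammar M V T ((\<lambda>(A, \<alpha>, n). (A, \<alpha>, h n)) ` P) S"
    using *(1) hom_in_carrier[OF h(1)] by (fastforce simp: val_grammar_def)
  moreover have "L = val_lang M T ((\<lambda>(A, \<alpha>, n). (A, \<alpha>, h n)) ` P) S"
    unfolding *(2) using *(1) by (intro val_lang_hom assms) (auto simp: val_grammar_def)
  ultimately show "L \<in> LValCF M" unfolding LValCF_def by blast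
qed

text \<open>The subgroup generated by the finitely many valences of the grammar is finite, and
  restricting the carrier changes no derivation step.\<close>

lemma (in group) locally_finite_LValCF_subset_CFL:
  assumes "locally_finite_group G"
  shows "LValCF G \<subseteq> CFL"
proof
  fix L assume "L \<in> LValCF G"
  then obtain V T P S where *: "val_grammar G V T P S" "L = val_lang G T P S"
    by (auto simp: LValCF_def)
  define Y where "Y = (\<lambda>(A, \<alpha>, n). n) ` P"
  define H where "H = generate G Y"
  let ?H = "G\<lparr>carrier := H\<rparr>"
  have Y: "finite Y" "Y \<subseteq> carrier G" using *(1) by (auto simp: val_grammar_def Y_def)
  have "finite H" using assms Y unfolding locally_finite_group_def H_def by blast
  moreover have "group ?H"
    unfolding H_def by (rule subgroup.subgroup_is_group[OF generate_is_subgroup[OF Y(2)] is_group])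
  ultimately have "LValCF ?H \<subseteq> CFL" using group.finite_LValCF_subset_CFL[of ?H] by simp
  moreover have "n \<in> H" if "(A, \<alpha>, n) \<in> P" for A \<alpha> n
    unfolding H_def using that by (intro generate.incl) (force simp: Y_def)
  then have "val_grammar ?H V T P S" using *(1) by (auto simp: val_grammar_def)
  moreover have "L = val_lang ?H T P S" by (simp add: *(2) val_lang_def val_step_def)
  ultimately show "L \<in> CFL" unfolding LValCF_def by blast
qed

section \<open>Copies of the bicyclic monoid and of the integers\<close>

lemma monoid_bicyclic: "monoid bicyclic"
  by (rule monoidI) (auto simp: bicyclic_def)

text \<open>Normal forms are mapped to q^a p^b. If this is 1 with a > 0, then q has a right inverse
  besides its left inverse p; if a = 0 and b > 0, then p has a left inverse besides its right
  inverse q. In both cases the two inverses coincide and qp = 1, a contradiction.\<close>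

lemma (in monoid) LValCF_bicyclic_subset:
  assumes pq: "p \<in> carrier G" "q \<in> carrier G" "p \<otimes> q = \<one>" "q \<otimes> p \<noteq> \<one>"
  shows "LValCF bicyclic \<subseteq> LValCF G"
proof (rule LValCF_subset_hom)
  let ?h = "\<lambda>(a :: nat, b :: nat). q [^] a \<otimes> p [^] b"
  have cancel: "p [^] b \<otimes> q [^] c = q [^] (c - b) \<otimes> p [^] (b - c)" for b c :: nat
  proof (induction b arbitrary: c)
    case (Suc b)
    show ?case
    proof (cases c)
      case (Suc c')
      have "p [^] Suc b \<otimes> q [^] Suc c' = p [^] b \<otimes> (p \<otimes> q) \<otimes> q [^] c'"
        using pq(1,2) nat_pow_Suc2[of q c'] by (simp add: m_assoc)
      also have "\<dots> = p [^] b \<otimes> q [^] c'" using pq by simp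
      finally show ?thesis using Suc.IH[of c'] Suc by simp
    qed (use pq in simp)
  qed (use pq in simp)
  have left: "q [^] a \<otimes> q [^] b = q [^] (a + b)" "p [^] a \<otimes> p [^] b = p [^] (a + b)" for a b :: nat
    using pq by (simp_all add: nat_pow_mult)
  show "?h \<in> hom bicyclic G"
  proof (rule homI)
    fix x y :: "nat \<times> nat"
    obtain a b c d where xy: "x = (a, b)" "y = (c, d)" by force
    have "q [^] a \<otimes> p [^] b \<otimes> (q [^] c \<otimes> p [^] d) = q [^] a \<otimes> (p [^] b \<otimes> q [^] c) \<otimes> p [^] d"
      using pq by (simp add: m_assoc)
    also have "\<dots> = q [^] (a + (c - b)) \<otimes> p [^] (b - c + d)"
      using pq unfolding cancel left[symmetric] by (simp add: m_assoc)
    finally show "?h (x \<otimes>\<^bsub>bicyclic\<^esub> y) = ?h x \<otimes> ?h y"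
      by (simp add: xy bicyclic_def add.commute)
  qed (use pq in auto)
  show "x = \<one>\<^bsub>bicyclic\<^esub>" if h1: "?h x = \<one>" for x
  proof -
    obtain a b where x: "x = (a, b)" by force
    consider "a = 0" "b = 0" | a' where "a = Suc a'" | b' where "a = 0" "b = Suc b'"
      by (cases a; cases b) auto
    then show ?thesis
    proof cases
      case 1
      then show ?thesis by (simp add: x bicyclic_def)
    next
      case 2
      define y where "y = q [^] a' \<otimes> p [^] b"
      have "q \<otimes> y = q [^] a \<otimes> p [^] b"
        using pq(1,2) unfolding 2 nat_pow_Suc2[OF pq(2)] y_def by (simp add: m_assoc)
      then have y: "y \<in> carrier G" "q \<otimes> y = \<one>"
        using h1 pq by (simp_all add: x y_def)
      with pq have "p = y" by (metis inv_unique)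
      with y pq show ?thesis by simp
    next
      case 3
      define y where "y = p [^] b'"
      have y: "y \<in> carrier G" "y \<otimes> p = \<one>"
        using h1 3 pq by (simp_all add: x y_def)
      with pq have "q = y" by (metis inv_unique)
      with y pq show ?thesis by simp
    qed
  qed
qed (use monoid_bicyclic monoid_axioms pq in \<open>auto simp: bicyclic_def\<close>)

lemma (in group) LValCF_integer_subset:
  assumes g: "g \<in> carrier G" "\<And>n :: nat. n > 0 \<Longrightarrow> g [^] n \<noteq> \<one>"
  shows "LValCF integer_group \<subseteq> LValCF G"
proof (rule LValCF_subset_hom)
  show "(\<lambda>n :: int. g [^] n) \<in> hom integer_group G"
    using g by (auto intro!: homI simp: integer_group_def int_pow_mult)
  show "n = \<one>\<^bsub>integer_group\<^esub>" if "g [^] n = \<one>" for n :: int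
  proof (rule ccontr)
    assume "n \<noteq> \<one>\<^bsub>integer_group\<^esub>"
    then have "nat \<bar>n\<bar> > 0" by (simp add: integer_group_def)
    moreover have "g [^] \<bar>n\<bar> = \<one>"
      using that g by (cases "n \<ge> 0") (simp_all add: int_pow_neg)
    then have "g [^] nat \<bar>n\<bar> = \<one>"
      by (metis abs_ge_zero int_pow_int nat_0_le)
    ultimately show False using g(2) by blast
  qed
qed (use group_integer_group is_monoid in \<open>auto simp: group.is_monoid integer_group_def\<close>)

section \<open>Reduction to the group of units\<close>

text \<open>The derivation is read backwards from its final value: each value is a product of the
  previous one and a valence, so both factors are units again.\<close>

lemma (in monoid) val_steps_units:
  assumes df: "\<And>p q. p \<in> carrier G \<Longrightarrow> q \<in> carrier G \<Longrightarrow> p \<otimes> q \<in> Units G \<Longrightarrow>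
      p \<in> Units G \<and> q \<in> Units G"
    and P: "\<forall>(A, \<alpha>, n) \<in> P. n \<in> carrier G"
    and steps: "((x, m), (y, m')) \<in> (val_step G P)\<^sup>*" "m \<in> carrier G" "m' \<in> Units G"
  shows "m \<in> Units G \<and> ((x, m), (y, m')) \<in> (val_step G {(A, \<alpha>, n) \<in> P. n \<in> Units G})\<^sup>*"
  using steps
proof (induction x m rule: converse_rtrancl_induct2)
  case (step x m x' m1)
  from step.hyps(1) obtain w1 A w2 \<alpha> n where
    *: "x = w1 @ [Inl A] @ w2" "x' = w1 @ \<alpha> @ w2" "(A, \<alpha>, n) \<in> P" "m1 = m \<otimes> n"
    by (auto simp: val_step_def)
  have n: "n \<in> carrier G" using P *(3) by auto
  have IH: "m1 \<in> Units G" "((x', m1), (y, m')) \<in> (val_step G {(A, \<alpha>, n) \<in> P. n \<in> Units G})\<^sup>*"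
    using step.IH step.prems n *(4) by auto
  then have "m \<in> Units G" "n \<in> Units G" using df[of m n] step.prems n *(4) by auto
  moreover from this have "((x, m), (x', m1)) \<in> val_step G {(A, \<alpha>, n) \<in> P. n \<in> Units G}"
    using * unfolding val_step_def by blast
  ultimately show ?case using IH(2) by (auto intro: converse_rtrancl_into_rtrancl)
qed simp

lemma (in monoid) LValCF_units:
  assumes df: "\<And>p q. p \<in> carrier G \<Longrightarrow> q \<in> carrier G \<Longrightarrow> p \<otimes> q = \<one> \<Longrightarrow> q \<otimes> p = \<one>"
  shows "LValCF G = LValCF (units_of G)"
proof
  show "LValCF (units_of G) \<subseteq> LValCF G"
    by (rule LValCF_subset_hom[where h = id])
      (use monoid_axioms units_group in \<open>auto intro!: homI simp: group.is_monoid units_of_def\<close>)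
next
  have df': "p \<in> Units G \<and> q \<in> Units G"
    if pq: "p \<in> carrier G" "q \<in> carrier G" "p \<otimes> q \<in> Units G" for p q
  proof -
    obtain r where r: "r \<in> carrier G" "p \<otimes> q \<otimes> r = \<one>" "r \<otimes> (p \<otimes> q) = \<one>"
      using pq(3) by (auto simp: Units_def)
    \<comment> \<open>With r inverse to pq, the element qr is a right inverse of p and rp a left
      inverse of q; by \<open>df\<close> both are two-sided.\<close>
    then have "p \<otimes> (q \<otimes> r) = \<one>" "(r \<otimes> p) \<otimes> q = \<one>" using pq r by (simp_all add: m_assoc)
    then show ?thesis
      using df[of p "q \<otimes> r"] df[of "r \<otimes> p" q] pq r(1) unfolding Units_def by blast
  qed
  show "LValCF G \<subseteq> LValCF (units_of G)"
  proof
    fix L assume "L \<in> LValCF G"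
    then obtain V T P S where *: "val_grammar G V T P S" "L = val_lang G T P S"
      by (auto simp: LValCF_def)
    define Q where "Q = {(A, \<alpha>, n) \<in> P. n \<in> Units G}"
    have Q: "Q \<subseteq> P" by (auto simp: Q_def)
    then have "val_grammar (units_of G) V T Q S"
      using *(1) finite_subset[OF Q] by (auto simp: val_grammar_def Q_def units_of_def)
    moreover have "val_step (units_of G) Q = val_step G Q"
      by (simp add: val_step_def units_of_def)
    moreover have "val_step G Q \<subseteq> val_step G P"
      using Q unfolding val_step_def by blast
    then have "(val_step G Q)\<^sup>* \<subseteq> (val_step G P)\<^sup>*" by (rule rtrancl_mono)
    moreover have "((x, \<one>), (y, \<one>)) \<in> (val_step G Q)\<^sup>*"
      if "((x, \<one>), (y, \<one>)) \<in> (val_step G P)\<^sup>*" for x y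
    proof -
      have "\<forall>(A, \<alpha>, n) \<in> P. n \<in> carrier G" using *(1) by (auto simp: val_grammar_def)
      from val_steps_units[OF df' this that] show ?thesis by (simp add: Q_def)
    qed
    ultimately have "L = val_lang (units_of G) T Q S"
      unfolding *(2) val_lang_def by (auto simp: units_of_def)
    with \<open>val_grammar (units_of G) V T Q S\<close> show "L \<in> LValCF (units_of G)"
      unfolding LValCF_def by blast
  qed
qed

section \<open>The case distinction on the monoid and its group of units\<close>

theorem theorem2:
  fixes M :: "'m monoid"
  assumes "monoid M"
  shows "LValCF M = CFL
       \<or> LValCF bicyclic \<subseteq> LValCF M
       \<or> LValCF integer_group \<subseteq> LValCF M
       \<or> (\<exists>G :: 'm monoid. group G \<and> infinite (carrier G) \<and> periodic_group G
            \<and> \<not> locally_finite_group G \<and> LValCF M = LValCF G)"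
proof -
  interpret monoid M by fact
  let ?G = "units_of M"
  interpret U: group ?G by (rule units_group)
  show ?thesis
  proof (cases "\<exists>p \<in> carrier M. \<exists>q \<in> carrier M. p \<otimes>\<^bsub>M\<^esub> q = \<one>\<^bsub>M\<^esub> \<and> q \<otimes>\<^bsub>M\<^esub> p \<noteq> \<one>\<^bsub>M\<^esub>")
    case True
    then show ?thesis using LValCF_bicyclic_subset by blast
  next
    case False
    then have M: "LValCF M = LValCF ?G" by (intro LValCF_units) blast
    consider "\<not> periodic_group ?G" | "locally_finite_group ?G"
      | "periodic_group ?G" "\<not> locally_finite_group ?G" by blast
    then show ?thesis
    proof cases
      case 1
      then show ?thesis
        using U.LValCF_integer_subset U.is_group M unfolding periodic_group_def by metis
    next
      case 2
      then show ?thesis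
        using U.locally_finite_LValCF_subset_CFL CFL_subset_LValCF M by blast
    next
      case 3
      \<comment> \<open>Generated subgroups lie in the carrier, so a finite group would be locally
        finite.\<close>
      have "infinite (carrier ?G)"
        using 3(2) U.generate_in_carrier U.is_group finite_subset
        unfolding locally_finite_group_def by (metis subsetI)
      with 3 M U.is_group show ?thesis by blast
    qed
  qed
qed

end
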